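(* Let $G$ be a finite reflexive graph and $G^*$ its avoidance graph. Then $G$ is a strong cocomparability graph if and only if $G^*$ is a comparability graph.
   Context: A graph is reflexive if every vertex carries a loop; its edge set $E(G)$ contains all loops $vv$, and an "edge" $uu'$ may be a loop ($u=u'$). The Slash matrix is the $2\times2$ matrix with rows $(0,1)$ and $(1,0)$; a matrix contains it as a submatrix if there are rows $i<j$ and columns $k<l$ with entries $(i,k)=0$, $(i,l)=1$, $(j,k)=1$, $(j,l)=0$. A reflexive graph is a strong cocomparability graph if its adjacency matrix (1's on the diagonal) admits a simultaneous row-and-column permutation that does not contain the Slash matrix as a submatrix. A comparability graph is a graph admitting a transitive orientation. For edges $uu'$, $vv'$ of $G$ with $\{u,u'\}\cap\{v,v'\}=\emptyset$, $uu'$ avoids $vv'$ if one of the following holds: (i) $u=u'$, $v=v'$, $uv\notin E(G)$; (ii) $u=u'$, $v\ne v'$, $uv\notin E(G)$ and $uv'\notin E(G)$; (iii) $u\ne u'$, $v=v'$, $uv\notin E(G)$ and $u'v\notin E(G)$; (iv) $u\ne u'$, $v\ne v'$, and $\{u,u',v,v'\}$ induces a $2K_2$, a $P_4$, or a $C_4$ in $G$. The avoidance graph $G^*$ is the (loopless) graph whose vertex set is $E(G)$ (including loops of $G$), two distinct elements $e,f$ being adjacent in $G^*$ iff $e$ avoids $f$ in $G$. *)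

theory Defs
  imports Main
begin

definition reflexive_graph :: "'a set \<Rightarrow> ('a \<Rightarrow> 'a \<Rightarrow> bool) \<Rightarrow> bool" where
  "reflexive_graph V adj \<longleftrightarrow>
     (\<forall>u\<in>V. \<forall>v\<in>V. adj u v \<longleftrightarrow> adj v u) \<and> (\<forall>v\<in>V. adj v v)"

text \<open>Edge set E(G): unordered pairs {u,u'} of adjacent vertices; loops are {v}.\<close>
definition edges :: "'a set \<Rightarrow> ('a \<Rightarrow> 'a \<Rightarrow> bool) \<Rightarrow> 'a set set" where
  "edges V adj = {{u, u'} | u u'. u \<in> V \<and> u' \<in> V \<and> adj u u'}"

text \<open>Strong cocomparability: a vertex ordering (simultaneous row/column
  permutation of the adjacency matrix) avoiding the Slash submatrix.\<close>
definition strong_cocomparability :: "'a set \<Rightarrow> ('a \<Rightarrow> 'a \<Rightarrow> bool) \<Rightarrow> bool" where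
  "strong_cocomparability V adj \<longleftrightarrow>
     (\<exists>f. bij_betw f {0..<card V} V \<and>
        \<not> (\<exists>i j k l. i < j \<and> j < card V \<and> k < l \<and> l < card V \<and>
              \<not> adj (f i) (f k) \<and> adj (f i) (f l) \<and> adj (f j) (f k) \<and> \<not> adj (f j) (f l)))"

definition twoK2 :: "nat \<Rightarrow> nat \<Rightarrow> bool" where
  "twoK2 i j \<longleftrightarrow> {i, j} = {0, 1} \<or> {i, j} = {2, 3}"
definition P4 :: "nat \<Rightarrow> nat \<Rightarrow> bool" where
  "P4 i j \<longleftrightarrow> {i, j} = {0, 1} \<or> {i, j} = {1, 2} \<or> {i, j} = {2, 3}"
definition C4 :: "nat \<Rightarrow> nat \<Rightarrow> bool" where
  "C4 i j \<longleftrightarrow> {i, j} = {0, 1} \<or> {i, j} = {1, 2} \<or> {i, j} = {2, 3} \<or> {i, j} = {3, 0}"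

definition induces :: "('a \<Rightarrow> 'a \<Rightarrow> bool) \<Rightarrow> 'a set \<Rightarrow> (nat \<Rightarrow> nat \<Rightarrow> bool) \<Rightarrow> bool" where
  "induces adj S H \<longleftrightarrow>
     (\<exists>g. bij_betw g {0..<4} S \<and>
        (\<forall>i<4. \<forall>j<4. i \<noteq> j \<longrightarrow> (adj (g i) (g j) \<longleftrightarrow> H i j)))"

definition avoids :: "('a \<Rightarrow> 'a \<Rightarrow> bool) \<Rightarrow> 'a set \<Rightarrow> 'a set \<Rightarrow> bool" where
  "avoids adj e f \<longleftrightarrow>
     (\<exists>u u' v v'. e = {u, u'} \<and> f = {v, v'} \<and> {u, u'} \<inter> {v, v'} = {} \<and>
        ((u = u' \<and> v = v' \<and> \<not> adj u v) \<or>
         (u = u' \<and> v \<noteq> v' \<and> \<not> adj u v \<and> \<not> adj u v') \<or>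
         (u \<noteq> u' \<and> v = v' \<and> \<not> adj u v \<and> \<not> adj u' v) \<or>
         (u \<noteq> u' \<and> v \<noteq> v' \<and>
            (induces adj {u, u', v, v'} twoK2 \<or> induces adj {u, u', v, v'} P4 \<or>
             induces adj {u, u', v, v'} C4))))"

definition avoidance_adj :: "'a set \<Rightarrow> ('a \<Rightarrow> 'a \<Rightarrow> bool) \<Rightarrow> 'a set \<Rightarrow> 'a set \<Rightarrow> bool" where
  "avoidance_adj V adj e f \<longleftrightarrow>
     e \<in> edges V adj \<and> f \<in> edges V adj \<and> e \<noteq> f \<and> avoids adj e f"

definition comparability_graph :: "'b set \<Rightarrow> ('b \<Rightarrow> 'b \<Rightarrow> bool) \<Rightarrow> bool" where
  "comparability_graph W R \<longleftrightarrow>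
     (\<exists>Ori. (\<forall>x y. Ori x y \<longrightarrow> x \<in> W \<and> y \<in> W \<and> R x y) \<and>
          (\<forall>x\<in>W. \<forall>y\<in>W. R x y \<longrightarrow> Ori x y \<or> Ori y x) \<and>
          (\<forall>x y. Ori x y \<longrightarrow> \<not> Ori y x) \<and>
          (\<forall>x y z. Ori x y \<longrightarrow> Ori y z \<longrightarrow> Ori x z))"

end

theory Submission
  imports Defs
begin

text \<open>
  Two edges avoid each other iff they can be written as {x, x'} and {y, y'} with x not adjacent
  to y' and y not adjacent to x'; a vertex ordering is Slash-free iff in every such situation
  x < y is equivalent to x' < y' (we say that (x, y) forces (x', y')). From an ordering, {x, x'} is
  placed before {y, y'} iff x < y, which is transitive.

  Conversely, a transitive orientation of the avoidance graph induces an orientation D of the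
  pairs (x, y) that is consistent with forcing. Such a D is transitive unless it has a 3-cycle.
  Vertices separating the members of a 3-cycle are either all adjacent to exactly one of them
  (then the three corresponding edges form a cycle in the avoidance graph, which is impossible)
  or all adjacent to exactly two. Cycles of the second kind do occur. To remove them, the
  forcing classes lying on such a cycle, for some consistent orientation, are reoriented by a
  potential: walking along forced pairs moves the cycle, and the potential of a vertex x of the
  cycle depends only on the vertices met in the position of x after an even number of steps and
  on those opposite to x after an odd number of steps. The two sets must enter antisymmetrically,
  because a single forcing step reverses the sense of rotation.
\<close>

locale finite_reflexive_graph =
  fixes V :: "'a set" and adj :: "'a \<Rightarrow> 'a \<Rightarrow> bool"
  assumes finite_V: "finite V" and reflexive: "reflexive_graph V adj"
begin

lemma adj_sym: "u \<in> V \<Longrightarrow> v \<in> V \<Longrightarrow> adj u v \<longleftrightarrow> adj v u"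
  using reflexive by (auto simp: reflexive_graph_def)

lemma adj_refl: "v \<in> V \<Longrightarrow> adj v v"
  using reflexive by (auto simp: reflexive_graph_def)

subsection \<open>Forcing between ordered pairs\<close>

definition forces :: "'a \<Rightarrow> 'a \<Rightarrow> 'a \<Rightarrow> 'a \<Rightarrow> bool" where
  "forces x y x' y' \<longleftrightarrow> x \<in> V \<and> y \<in> V \<and> x' \<in> V \<and> y' \<in> V \<and>
     adj x x' \<and> adj y y' \<and> \<not> adj x y' \<and> \<not> adj y x'"

lemma forces_sym: "forces x y x' y' \<longleftrightarrow> forces x' y' x y"
  unfolding forces_def using adj_sym by blast

lemma forces_swap: "forces x y x' y' \<longleftrightarrow> forces y x y' x'"
  unfolding forces_def by blast

lemma forces_disjoint: "forces x y x' y' \<Longrightarrow> {x, x'} \<inter> {y, y'} = {}"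
  unfolding forces_def using adj_sym adj_refl by blast

text \<open>The conditions on the two partners are independent: the first must lie in N[x] - N[y],
  the second in N[y] - N[x]. So a pair of vertices is constrained iff their closed neighbourhoods
  are incomparable.\<close>

lemma forces_mix: "forces x y a b \<Longrightarrow> forces x y c d \<Longrightarrow> forces x y a d"
  unfolding forces_def by blast

text \<open>In 2K2, P4 and C4 any two disjoint edges extend to a 4-cycle alternating between edges
  and non-edges.\<close>

lemma induces_pairs:
  assumes "induces adj {u, u', v, v'} H" and "H = twoK2 \<or> H = P4 \<or> H = C4"
    and "distinct [u, u', v, v']" and "adj u u'" "adj v v'"
  shows "\<not> adj u v \<and> \<not> adj u' v' \<or> \<not> adj u v' \<and> \<not> adj u' v"
proof -
  from assms(1) obtain g where g: "bij_betw g {0..<4} {u, u', v, v'}"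
    and H: "\<And>i j. i < 4 \<Longrightarrow> j < 4 \<Longrightarrow> i \<noteq> j \<Longrightarrow> adj (g i) (g j) \<longleftrightarrow> H i j"
    unfolding induces_def by blast
  have S: "g ` {0..<4} = {u, u', v, v'}" using g by (simp add: bij_betw_def)
  have "\<exists>i<4. w = g i" if "w \<in> {u, u', v, v'}" for w
    using that unfolding S[symmetric] by auto
  then obtain i j k l where i: "i < 4" "u = g i" and j: "j < 4" "u' = g j"
    and k: "k < 4" "v = g k" and l: "l < 4" "v' = g l"
    by (meson insertI1 insertI2)
  have d: "i \<noteq> j" "i \<noteq> k" "i \<noteq> l" "j \<noteq> k" "j \<noteq> l" "k \<noteq> l"
    using assms(3) i j k l by auto
  have e: "H i j" "H k l" using H assms(4,5) i j k l d by auto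
  have "\<not> H i k \<and> \<not> H j l \<or> \<not> H i l \<and> \<not> H j k"
    using assms(2) d e
    by (elim disjE; hypsubst) (auto simp: twoK2_def P4_def C4_def doubleton_eq_iff)
  then show ?thesis using H i j k l d by auto
qed

lemma inducesI:
  assumes "distinct [a, b, c, d]" and "{a, b, c, d} = S"
    and "{a, b, c, d} \<subseteq> V"
    and "adj a b \<longleftrightarrow> H 0 1" "adj a c \<longleftrightarrow> H 0 2" "adj a d \<longleftrightarrow> H 0 3"
    and "adj b c \<longleftrightarrow> H 1 2" "adj b d \<longleftrightarrow> H 1 3" "adj c d \<longleftrightarrow> H 2 3"
    and "\<And>i j. H i j \<longleftrightarrow> H j i"
  shows "induces adj S H"
proof -
  let ?g = "\<lambda>i. [a, b, c, d] ! i"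
  have "bij_betw ?g {0..<4} S"
    using bij_betw_nth[OF assms(1), of "{0..<4}" S] assms(2) by (simp add: atLeast0LessThan)
  moreover have "\<forall>i<4. \<forall>j<4. i \<noteq> j \<longrightarrow> (adj (?g i) (?g j) \<longleftrightarrow> H i j)"
  proof (intro allI impI)
    fix i j :: nat
    assume "i < 4" "j < 4" "i \<noteq> j"
    then have "i \<in> {0, 1, 2, 3}" "j \<in> {0, 1, 2, 3}" "i \<noteq> j" by auto
    moreover have "adj b a \<longleftrightarrow> adj a b" "adj c a \<longleftrightarrow> adj a c" "adj d a \<longleftrightarrow> adj a d"
      "adj c b \<longleftrightarrow> adj b c" "adj d b \<longleftrightarrow> adj b d" "adj d c \<longleftrightarrow> adj c d"
      using assms(3) adj_sym by auto
    ultimately show "adj (?g i) (?g j) \<longleftrightarrow> H i j"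
      using assms(4-9) assms(10)
      by (elim insertE emptyE) (simp_all add: numeral_2_eq_2 numeral_3_eq_3)
  qed
  ultimately show ?thesis unfolding induces_def by blast
qed

lemma forces_avoids:
  assumes f: "forces x y x' y'"
  shows "avoids adj {x, x'} {y, y'}"
proof -
  note d = forces_disjoint[OF f]
  have m: "x \<in> V" "y \<in> V" "x' \<in> V" "y' \<in> V" and a: "adj x x'" "adj y y'" "adj x' x" "adj y' y"
    and n: "\<not> adj x y'" "\<not> adj y' x" "\<not> adj y x'" "\<not> adj x' y"
    using f adj_sym unfolding forces_def by auto
  have "x \<noteq> x' \<Longrightarrow> y \<noteq> y' \<Longrightarrow>
    induces adj {x, x', y, y'} twoK2 \<or> induces adj {x, x', y, y'} P4 \<or> induces adj {x, x', y, y'} C4"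
  proof -
    assume ne: "x \<noteq> x'" "y \<noteq> y'"
    have Hs: "twoK2 i j \<longleftrightarrow> twoK2 j i" "P4 i j \<longleftrightarrow> P4 j i" "C4 i j \<longleftrightarrow> C4 j i" for i j
      by (auto simp: twoK2_def P4_def C4_def insert_commute)
    note defs = twoK2_def P4_def C4_def doubleton_eq_iff
    have s: "adj y x \<longleftrightarrow> adj x y" "adj y' x' \<longleftrightarrow> adj x' y'" using adj_sym m by auto
    \<comment> \<open>Forcing decides four of the six pairs. The remaining two, x y and x' y', give
      2K2, P4 or C4 when none, one or both are edges.\<close>
    consider "\<not> adj x y" "\<not> adj x' y'" | "\<not> adj x y" "adj x' y'"
      | "adj x y" "\<not> adj x' y'" | "adj x y" "adj x' y'" by blast
    then show ?thesis
    proof cases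
      case 1
      have "induces adj {x, x', y, y'} twoK2"
        by (rule inducesI[of x x' y y']) (use 1 ne d m a n s Hs in \<open>auto simp: defs\<close>)
      then show ?thesis by blast
    next
      case 2
      have "induces adj {x, x', y, y'} P4"
        by (rule inducesI[of x x' y' y]) (use 2 ne d m a n s Hs in \<open>auto simp: defs\<close>)
      then show ?thesis by blast
    next
      case 3
      have "induces adj {x, x', y, y'} P4"
        by (rule inducesI[of x' x y y']) (use 3 ne d m a n s Hs in \<open>auto simp: defs\<close>)
      then show ?thesis by blast
    next
      case 4
      have "induces adj {x, x', y, y'} C4"
        by (rule inducesI[of x x' y' y]) (use 4 ne d m a n s Hs in \<open>auto simp: defs\<close>)
      then show ?thesis by blast
    qed
  qed
  then show ?thesis
    unfolding avoids_def
    by (intro exI[of _ x] exI[of _ x'] exI[of _ y] exI[of _ y']) (use d m a n in auto)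
qed

lemma avoids_forces:
  assumes "avoids adj e g" and "e \<in> edges V adj" and "g \<in> edges V adj"
  shows "\<exists>x y x' y'. e = {x, x'} \<and> g = {y, y'} \<and> forces x y x' y'"
proof -
  from assms(1) obtain u u' v v' where e: "e = {u, u'}" and g: "g = {v, v'}"
    and d: "{u, u'} \<inter> {v, v'} = {}"
    and c: "(u = u' \<and> v = v' \<and> \<not> adj u v) \<or>
         (u = u' \<and> v \<noteq> v' \<and> \<not> adj u v \<and> \<not> adj u v') \<or>
         (u \<noteq> u' \<and> v = v' \<and> \<not> adj u v \<and> \<not> adj u' v) \<or>
         (u \<noteq> u' \<and> v \<noteq> v' \<and>
            (induces adj {u, u', v, v'} twoK2 \<or> induces adj {u, u', v, v'} P4 \<or>
             induces adj {u, u', v, v'} C4))"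
    unfolding avoids_def by blast
  have m: "u \<in> V" "u' \<in> V" "v \<in> V" "v' \<in> V" and a: "adj u u'" "adj v v'"
    using assms(2,3) e g adj_sym unfolding edges_def by (auto simp: doubleton_eq_iff)
  have "\<not> adj u v \<and> \<not> adj u' v' \<or> \<not> adj u v' \<and> \<not> adj u' v"
    using c
  proof (elim disjE conjE)
    assume "u \<noteq> u'" "v \<noteq> v'" "induces adj {u, u', v, v'} twoK2"
    then show ?thesis using induces_pairs[of u u' v v' twoK2] d a by auto
  next
    assume "u \<noteq> u'" "v \<noteq> v'" "induces adj {u, u', v, v'} P4"
    then show ?thesis using induces_pairs[of u u' v v' P4] d a by auto
  next
    assume "u \<noteq> u'" "v \<noteq> v'" "induces adj {u, u', v, v'} C4"
    then show ?thesis using induces_pairs[of u u' v v' C4] d a by auto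
  qed auto
  then have "forces u v' u' v \<or> forces u v u' v'"
    unfolding forces_def using m a adj_sym by blast
  then show ?thesis using e g by (metis insert_commute)
qed

text \<open>One condition in place of the four clauses; loops are the cases x = x' or y =
  y'.\<close>

lemma avoidance_adj_iff:
  "avoidance_adj V adj e g \<longleftrightarrow> (\<exists>x y x' y'. e = {x, x'} \<and> g = {y, y'} \<and> forces x y x' y')"
proof
  assume "avoidance_adj V adj e g"
  then show "\<exists>x y x' y'. e = {x, x'} \<and> g = {y, y'} \<and> forces x y x' y'"
    unfolding avoidance_adj_def using avoids_forces by blast
next
  assume "\<exists>x y x' y'. e = {x, x'} \<and> g = {y, y'} \<and> forces x y x' y'"
  then obtain x y x' y' where e: "e = {x, x'}" and g: "g = {y, y'}" and f: "forces x y x' y'"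
    by blast
  have "e \<in> edges V adj" "g \<in> edges V adj"
    using f e g unfolding forces_def edges_def by blast+
  moreover have "e \<noteq> g" using forces_disjoint[OF f] e g by blast
  ultimately show "avoidance_adj V adj e g"
    unfolding avoidance_adj_def using forces_avoids[OF f] e g by blast
qed

lemma avoidance_adj_disjoint: "avoidance_adj V adj e g \<Longrightarrow> e \<inter> g = {}"
  unfolding avoidance_adj_iff using forces_disjoint by blast

subsection \<open>Consistent orientations\<close>

definition consistent :: "('a \<Rightarrow> 'a \<Rightarrow> bool) \<Rightarrow> bool" where
  "consistent D \<longleftrightarrow>
     (\<forall>x y x' y'. forces x y x' y' \<longrightarrow> (D x y \<longleftrightarrow> D x' y') \<and> (D x y \<or> D y x)) \<and>
     (\<forall>x y. D x y \<longrightarrow> \<not> D y x \<and> (\<exists>x' y'. forces x y x' y'))"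

lemma consistent_forces: "consistent D \<Longrightarrow> forces x y x' y' \<Longrightarrow> D x y \<longleftrightarrow> D x' y'"
  unfolding consistent_def by blast

lemma consistent_total: "consistent D \<Longrightarrow> forces x y x' y' \<Longrightarrow> D x y \<or> D y x"
  unfolding consistent_def by blast

lemma consistent_asym: "consistent D \<Longrightarrow> D x y \<Longrightarrow> \<not> D y x"
  unfolding consistent_def by blast

lemma consistent_constrained:
  assumes "consistent D" "D x y" obtains x' y' where "forces x y x' y'"
  using assms unfolding consistent_def by blast

lemma consistent_converse: "consistent D \<Longrightarrow> consistent (\<lambda>x y. D y x)"
  unfolding consistent_def using forces_swap by blast

text \<open>If x and z had nested closed neighbourhoods, then (x, y) would be forced together with
  (z, y).\<close>
lemma consistent_chain_constrained:
  assumes D: "consistent D" and xy: "D x y" and yz: "D y z"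
  shows "\<exists>x' z'. forces x z x' z'"
proof (rule ccontr)
  assume *: "\<nexists>x' z'. forces x z x' z'"
  obtain a b where ab: "forces x y a b" using consistent_constrained[OF D xy] .
  obtain c d where cd: "forces y z c d" using consistent_constrained[OF D yz] .
  have "(\<forall>u\<in>V. adj x u \<longrightarrow> adj z u) \<or> (\<forall>u\<in>V. adj z u \<longrightarrow> adj x u)"
    using * ab cd unfolding forces_def by blast
  then show False
  proof
    assume "\<forall>u\<in>V. adj x u \<longrightarrow> adj z u"
    then have "forces y z c a" "forces x y a c"
      using ab cd adj_sym unfolding forces_def by blast+
    then show False
      using consistent_forces[OF D] consistent_asym[OF D] xy yz by blast
  next
    assume "\<forall>u\<in>V. adj z u \<longrightarrow> adj x u"
    then have "forces y z b d" "forces x y d b"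
      using ab cd adj_sym unfolding forces_def by blast+
    then show False
      using consistent_forces[OF D] consistent_asym[OF D] xy yz by blast
  qed
qed

section \<open>Vertices separating the members of a 3-cycle\<close>

definition only :: "'a \<Rightarrow> 'a \<Rightarrow> 'a \<Rightarrow> 'a \<Rightarrow> bool" where
  "only u x y z \<longleftrightarrow> u \<in> V \<and> adj x u \<and> \<not> adj y u \<and> \<not> adj z u"

definition but :: "'a \<Rightarrow> 'a \<Rightarrow> 'a \<Rightarrow> 'a \<Rightarrow> bool" where
  "but u x y z \<longleftrightarrow> u \<in> V \<and> adj x u \<and> adj y u \<and> \<not> adj z u"

definition cycle :: "('a \<Rightarrow> 'a \<Rightarrow> bool) \<Rightarrow> 'a \<Rightarrow> 'a \<Rightarrow> 'a \<Rightarrow> bool" where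
  "cycle D x y z \<longleftrightarrow> D x y \<and> D y z \<and> D z x"

lemma cycle_rotate: "cycle D x y z \<Longrightarrow> cycle D y z x"
  unfolding cycle_def by blast

lemma only_commute: "only u x y z \<longleftrightarrow> only u x z y"
  unfolding only_def by blast

lemma but_commute: "but u x y z \<longleftrightarrow> but u y x z"
  unfolding but_def by blast

lemma cycle_in_V:
  assumes "consistent D" "cycle D x y z" shows "x \<in> V" "y \<in> V" "z \<in> V"
  using assms unfolding cycle_def consistent_def forces_def by blast+

text \<open>The arcs from x to y and from y to z would force both (w, u) and (u, w).\<close>

lemma cycle_only_but:
  assumes D: "consistent D" and c: "cycle D x y z" and y: "only u y x z" and xz: "but w x z y"
  shows False
proof -
  have "forces x y w u" "forces y z u w"
    using cycle_in_V[OF D c] y xz unfolding forces_def only_def but_def by auto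
  then show False
    using c consistent_forces[OF D] consistent_asym[OF D] unfolding cycle_def by blast
qed

lemma cycle_separators:
  assumes "consistent D" "cycle D x y z"
  shows "(\<exists>u. only u x y z) \<or> (\<exists>u. but u x z y)" "(\<exists>u. only u y z x) \<or> (\<exists>u. but u y z x)"
proof -
  have "D x y" using assms(2) unfolding cycle_def by blast
  then obtain a b where "forces x y a b" using consistent_constrained[OF assms(1)] by blast
  then show "(\<exists>u. only u x y z) \<or> (\<exists>u. but u x z y)" "(\<exists>u. only u y z x) \<or> (\<exists>u. but u y z x)"
    unfolding forces_def only_def but_def by blast+
qed

text \<open>By \<open>cycle_only_but\<close>, a vertex adjacent to x alone excludes one adjacent to
  exactly y and z. By \<open>cycle_separators\<close>, y and z then have such private neighbours as
  well, and every \<open>but\<close> is excluded. If x has none, the same exclusion works the other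
  way round.\<close>

lemma cycle_dichotomy:
  assumes D: "consistent D" and c: "cycle D x y z"
  obtains
    (one) "\<exists>u. only u x y z" "\<exists>u. only u y z x" "\<exists>u. only u z x y"
      "\<nexists>u. but u x y z" "\<nexists>u. but u y z x" "\<nexists>u. but u z x y"
  | (two) "\<exists>u. but u x y z" "\<exists>u. but u y z x" "\<exists>u. but u z x y"
      "\<nexists>u. only u x y z" "\<nexists>u. only u y z x" "\<nexists>u. only u z x y"
proof -
  note c' = cycle_rotate[OF c] and c'' = cycle_rotate[OF cycle_rotate[OF c]]
  note s = cycle_separators[OF D c] cycle_separators[OF D c'] cycle_separators[OF D c'']
  note n = cycle_only_but[OF D c] cycle_only_but[OF D c'] cycle_only_but[OF D c'']
  show thesis
  proof (cases "\<exists>u. only u x y z")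
    case True
    then show thesis using s n one only_commute but_commute by metis
  next
    case False
    then show thesis using s n two only_commute but_commute by metis
  qed
qed

section \<open>Antimatched cycles and walks along forced pairs\<close>

text \<open>For a consistent D, a single witness c already puts the cycle in the second case of
  \<open>cycle_dichotomy\<close>. It is kept as an argument because it replaces z after a forcing
  step.\<close>

definition antimatched :: "('a \<Rightarrow> 'a \<Rightarrow> bool) \<Rightarrow> 'a \<Rightarrow> 'a \<Rightarrow> 'a \<Rightarrow> 'a \<Rightarrow> bool" where
  "antimatched D x y z c \<longleftrightarrow> cycle D x y z \<and> but c x y z"

lemma antimatched_no_only:
  assumes "consistent D" "antimatched D x y z c"
  shows "\<not> only u x y z" "\<not> only u y z x" "\<not> only u z x y"
  using cycle_dichotomy[OF assms(1)] assms(2) unfolding antimatched_def by metis+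

lemma antimatched_rotate:
  assumes "consistent D" "antimatched D x y z c"
  obtains a where "antimatched D y z x a"
  using cycle_dichotomy[OF assms(1)] cycle_rotate assms(2) unfolding antimatched_def by metis

text \<open>No vertex is adjacent to exactly one of x, y, z, so x' and y' are both adjacent to z.
  Hence the arcs z x and y z are forced onto y' c and c x': the triangle moves to x', y', c, and z
  becomes the new witness.\<close>

lemma antimatched_step:
  assumes D: "consistent D" and t: "antimatched D x y z c" and f: "forces x y x' y'"
  shows "antimatched D x' y' c z" "forces z x y' c" "forces y z c x'"
proof -
  have c: "cycle D x y z" and b: "but c x y z" using t unfolding antimatched_def by auto
  note V = cycle_in_V[OF D c]
  have "adj z x'" "adj z y'"
    using antimatched_no_only[OF D t] f unfolding only_def forces_def by blast+
  then show 1: "forces z x y' c" and 2: "forces y z c x'"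
    using V b f unfolding forces_def but_def by blast+
  have "cycle D x' y' c"
    using c consistent_forces[OF D] f 1 2 unfolding cycle_def by blast
  moreover have "but z x' y' c"
    using V f 1 2 adj_sym unfolding but_def forces_def by blast
  ultimately show "antimatched D x' y' c z" unfolding antimatched_def by blast
qed

text \<open>The flag records parity: \<open>True\<close> stands for an even number of forcing
  steps.\<close>

inductive walk :: "'a \<Rightarrow> 'a \<Rightarrow> bool \<Rightarrow> 'a \<Rightarrow> 'a \<Rightarrow> bool" for x y where
  refl: "walk x y True x y"
| step: "walk x y b p q \<Longrightarrow> forces p q p' q' \<Longrightarrow> walk x y (\<not> b) p' q'"

lemma walk_trans: "walk p q c r s \<Longrightarrow> walk x y b p q \<Longrightarrow> walk x y (b = c) r s"
proof (induction rule: walk.induct)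
  case refl
  then show ?case by simp
next
  case (step c r s r' s')
  from walk.step[OF step.IH[OF step.prems] step.hyps(2)]
  show ?case by (metis (full_types))
qed

lemma walk_forces: "forces x y x' y' \<Longrightarrow> walk x y False x' y'"
  using walk.step[OF walk.refl] by fastforce

lemma walk_sym: "walk x y b p q \<Longrightarrow> walk p q b x y"
proof (induction rule: walk.induct)
  case refl
  show ?case by (rule walk.refl)
next
  case (step b p q p' q')
  then have "walk p' q' False p q" using forces_sym walk_forces by blast
  from walk_trans[OF step.IH this] show ?case by simp
qed

lemma walk_swap: "walk x y b p q \<Longrightarrow> walk y x b q p"
proof (induction rule: walk.induct)
  case refl
  show ?case by (rule walk.refl)
next
  case (step b p q p' q')
  then show ?case using forces_swap walk.step by blast
qed

text \<open>Along a walk, the third vertex of the cycle alternates between z and c.\<close>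
lemma antimatched_walk:
  assumes D: "consistent D" and t: "antimatched D x y z c" and w: "walk x y b p q"
  shows "if b then antimatched D p q z c \<and> walk y z True q z \<and> walk z x True z p
    else antimatched D p q c z \<and> walk z x False q c \<and> walk y z False c p"
  using w
proof (induction rule: walk.induct)
  case refl
  show ?case using t walk.refl by simp
next
  case (step b p q p' q')
  show ?case
  proof (cases b)
    case True
    then have IH: "antimatched D p q z c" "walk y z True q z" "walk z x True z p"
      using step.IH by auto
    note s = antimatched_step[OF D IH(1) step.hyps(2)]
    show ?thesis
      using True s(1) walk.step[OF IH(3) s(2)] walk.step[OF IH(2) s(3)] by simp
  next
    case False
    then have IH: "antimatched D p q c z" "walk z x False q c" "walk y z False c p"
      using step.IH by auto
    note s = antimatched_step[OF D IH(1) step.hyps(2)]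
    show ?thesis
      using False s(1) walk.step[OF IH(3) s(2)] walk.step[OF IH(2) s(3)] by simp
  qed
qed

lemma antimatched_walk_even:
  assumes "consistent D" "antimatched D x y z c" "walk x y True p q"
  shows "antimatched D p q z c" "walk y z True q z" "walk z x True z p"
  using antimatched_walk[OF assms] by simp_all

lemma antimatched_walk_odd:
  assumes "consistent D" "antimatched D x y z c" "walk x y False p q"
  shows "antimatched D p q c z" "walk z x False q c" "walk y z False c p"
  using antimatched_walk[OF assms] by simp_all

lemma antimatched_cycle: "antimatched D x y z c \<Longrightarrow> D x y \<and> D y z \<and> D z x"
  unfolding antimatched_def cycle_def by blast

subsection \<open>A potential\<close>

definition evens :: "'a \<Rightarrow> 'a \<Rightarrow> 'a set" where
  "evens x y = {a. \<exists>b. walk x y True a b}"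

definition odds :: "'a \<Rightarrow> 'a \<Rightarrow> 'a set" where
  "odds x y = {a. \<exists>b. walk x y False b a}"

text \<open>Prepending one step flips the parity, and swapping the coordinates along a walk
  exchanges first and second position.\<close>

lemma evens_odds_forces:
  assumes f: "forces x y x' y'"
  shows "evens x' y' = odds y x" "odds x' y' = evens y x"
proof -
  have w: "walk x' y' b p q \<longleftrightarrow> walk x y (\<not> b) p q" for b p q
    using walk_trans[of x' y' b p q x y False] walk_trans[of x y "\<not> b" p q x' y' False]
      walk_forces[OF f] walk_sym[OF walk_forces[OF f]] by auto
  show "evens x' y' = odds y x" "odds x' y' = evens y x"
    unfolding evens_def odds_def w by (auto dest: walk_swap)
qed

text \<open>The first vertex of an antimatched cycle determines these sets.\<close>
lemma evens_odds_antimatched: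
  assumes D: "consistent D" and t: "antimatched D x y z c"
  shows "evens x y = evens x z" "odds x y = odds x z"
proof -
  obtain a where a: "antimatched D y z x a" using antimatched_rotate[OF D t] .
  obtain b where b: "antimatched D z x y b" using antimatched_rotate[OF D a] .
  have "\<exists>v. walk x z True u v" if "walk x y True u w" for u w
    using antimatched_walk_even(3)[OF D t that] walk_swap by blast
  \<comment> \<open>The reverse inclusion is read off from the cycle rotated to z, x, y.\<close>
  moreover have "\<exists>v. walk x y True u v" if "walk x z True u w" for u w
    using antimatched_walk_even(2)[OF D b walk_swap[OF that]] by blast
  ultimately show "evens x y = evens x z" unfolding evens_def by blast
  have "\<exists>v. walk x z False v u" if "walk x y False w u" for u w
    using antimatched_walk_odd(2)[OF D t that] walk_swap by blast
  moreover have "\<exists>v. walk x y False v u" if "walk x z False w u" for u w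
    using antimatched_walk_odd(3)[OF D b walk_swap[OF that]] by blast
  ultimately show "odds x y = odds x z" unfolding odds_def by blast
qed

text \<open>An even walk keeps the third vertex z, so D has an arc from z to every member of
  \<open>evens x y\<close> and an arc to z from every member of \<open>evens y x\<close>.\<close>

lemma evens_disjoint:
  assumes D: "consistent D" and t: "antimatched D x y z c"
  shows "evens x y \<inter> evens y x = {}"
proof -
  have False if "walk x y True a q" "walk y x True a p" for a p q
    using antimatched_walk_even(1)[OF D t that(1)]
      antimatched_walk_even(1)[OF D t walk_swap[OF that(2)]]
      antimatched_cycle consistent_asym[OF D] by blast
  then show ?thesis unfolding evens_def by blast
qed

text \<open>As for even walks, but the third vertex is now c: members of \<open>odds x y\<close>
  have an arc to c, members of \<open>odds y x\<close> an arc from c.\<close>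

lemma odds_disjoint:
  assumes D: "consistent D" and t: "antimatched D x y z c"
  shows "odds x y \<inter> odds y x = {}"
proof -
  have False if "walk x y False q a" "walk y x False p a" for a p q
    using antimatched_walk_odd(1)[OF D t that(1)]
      antimatched_walk_odd(1)[OF D t walk_swap[OF that(2)]]
      antimatched_cycle consistent_asym[OF D] by blast
  then show ?thesis unfolding odds_def by blast
qed

text \<open>Vertices a and b witnessing the contrary would satisfy both a \<rightarrow> b and b \<rightarrow> a.\<close>
lemma evens_odds_disjoint:
  assumes D: "consistent D" and t: "antimatched D x y z c"
  shows "evens x y \<inter> odds x y = {} \<or> evens y x \<inter> odds y x = {}"
proof (rule ccontr)
  assume "\<not> ?thesis"
  then obtain a b p q p' q' where a: "walk x y True a q" "walk x y False p a"
    and b: "walk y x True b q'" "walk y x False p' b"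
    unfolding evens_def odds_def by blast
  note ae = antimatched_walk_even[OF D t a(1)] and ao = antimatched_walk_odd[OF D t a(2)]
  note be = antimatched_walk_even[OF D t walk_swap[OF b(1)]]
    and bo = antimatched_walk_odd[OF D t walk_swap[OF b(2)]]
  \<comment> \<open>An even walk from (q, z) to (b, z) keeps the third vertex a, so b, z, a is again
    a cycle and contains the arc from a to b.\<close>
  obtain e where "antimatched D q z a e" using antimatched_rotate[OF D ae(1)] .
  moreover have "walk q z True b z"
    using walk_trans[OF be(2) walk_sym[OF ae(2)]] by simp
  ultimately have "D a b"
    using antimatched_walk_even(1)[OF D] antimatched_cycle by blast
  \<comment> \<open>Likewise on the odd side: (p', c) is moved to (a, c) with third vertex
    b.\<close>
  obtain e where "antimatched D p' c b e" using antimatched_rotate[OF D bo(1)] .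
  moreover have "walk p' c True a c"
    using walk_trans[OF ao(2) walk_sym[OF bo(2)]] by simp
  ultimately have "D b a"
    using antimatched_walk_even(1)[OF D] antimatched_cycle by blast
  with \<open>D a b\<close> show False using consistent_asym[OF D] by blast
qed

definition label :: "'a \<Rightarrow> nat" where
  "label = (SOME h. bij_betw h V {0..<card V})"

lemma label: "bij_betw label V {0..<card V}"
  unfolding label_def using ex_bij_betw_finite_nat[OF finite_V] by (rule someI_ex)

definition least_label :: "'a set \<Rightarrow> nat" where
  "least_label A = (LEAST n. n \<in> label ` A)"

lemma least_label_in: "A \<noteq> {} \<Longrightarrow> least_label A \<in> label ` A"
  unfolding least_label_def by (rule LeastI_ex) blast

lemma least_label_less: "A \<noteq> {} \<Longrightarrow> A \<subseteq> V \<Longrightarrow> least_label A < card V"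
  using least_label_in[of A] label unfolding bij_betw_def
  by (metis atLeastLessThan_iff image_mono in_mono)

lemma least_label_eq:
  assumes "A \<noteq> {}" "B \<noteq> {}" "A \<subseteq> V" "B \<subseteq> V" "least_label A = least_label B"
  shows "A \<inter> B \<noteq> {}"
proof -
  obtain a b where "a \<in> A" "b \<in> B" "label a = label b"
    using least_label_in[OF assms(1)] least_label_in[OF assms(2)] assms(5) by auto
  moreover have "a = b"
    using calculation assms(3,4) label unfolding bij_betw_def inj_on_def by blast
  ultimately show ?thesis by blast
qed

text \<open>Antisymmetric in its arguments: sets whose least label is the smaller one come first,
  increasingly; the others come last, in the mirrored order.\<close>
definition balance :: "'a set \<Rightarrow> 'a set \<Rightarrow> int" where
  "balance A B = (let p = least_label A; q = least_label B in
     if p < q then int p - int (card V) else if q < p then int (card V) - int q else 0)"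

lemma balance_antisym: "balance B A = - balance A B"
  unfolding balance_def Let_def by simp

text \<open>Labels are below \<open>card V\<close>, so the sign of the balance tells which least
  label is smaller, and a nonzero value determines that label. Equal least labels give a common
  element.\<close>

lemma balance_eq:
  assumes "A \<noteq> {}" "B \<noteq> {}" "A' \<noteq> {}" "B' \<noteq> {}"
    and "A \<subseteq> V" "B \<subseteq> V" "A' \<subseteq> V" "B' \<subseteq> V"
    and "balance A B = balance A' B'"
  shows "A \<inter> A' \<noteq> {} \<or> B \<inter> B' \<noteq> {} \<or> A \<inter> B \<noteq> {} \<and> A' \<inter> B' \<noteq> {}"
proof -
  have "least_label A < card V" "least_label B < card V"
    "least_label A' < card V" "least_label B' < card V"
    using assms(1-8) least_label_less by blast+
  with assms(9) have "least_label A = least_label A' \<or> least_label B = least_label B' \<or>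
    least_label A = least_label B \<and> least_label A' = least_label B'"
    unfolding balance_def Let_def by (simp split: if_splits)
  then show ?thesis
    using least_label_eq[of A A'] least_label_eq[of B B'] least_label_eq[of A B]
      least_label_eq[of A' B'] assms(1-8) by argo
qed

definition height :: "'a \<Rightarrow> 'a \<Rightarrow> int" where
  "height x y = balance (evens x y) (odds x y)"

text \<open>Forcing exchanges the two sets, so the antisymmetry of \<open>balance\<close> turns this
  into a sign. As both heights of a pair are swapped and negated, their comparison is invariant
  under forcing.\<close>

lemma height_forces: "forces x y x' y' \<Longrightarrow> height x' y' = - height y x"
  unfolding height_def using evens_odds_forces balance_antisym by metis

lemma walk_in_V: "walk x y b p q \<Longrightarrow> x \<in> V \<Longrightarrow> y \<in> V \<Longrightarrow> p \<in> V \<and> q \<in> V"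
  by (induction rule: walk.induct) (auto simp: forces_def)

text \<open>On an antimatched cycle the height is thus a function of the vertex alone, with
  different values at x and y.\<close>

lemma height_antimatched:
  assumes D: "consistent D" and t: "antimatched D x y z c"
  shows "height x y = height x z" "height x y \<noteq> height y x"
proof -
  show "height x y = height x z"
    unfolding height_def evens_odds_antimatched[OF D t] ..
  have c: "D x y" using antimatched_cycle[OF t] by blast
  obtain x' y' where f: "forces x y x' y'" using consistent_constrained[OF D c] .
  have V: "x \<in> V" "y \<in> V" using f unfolding forces_def by auto
  have ne: "evens x y \<noteq> {}" "odds x y \<noteq> {}" "evens y x \<noteq> {}" "odds y x \<noteq> {}"
    using walk.refl walk_forces[OF f] walk_swap unfolding evens_def odds_def by blast+
  have "evens x y \<subseteq> V" "odds x y \<subseteq> V" "evens y x \<subseteq> V" "odds y x \<subseteq> V"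
    using walk_in_V V unfolding evens_def odds_def by blast+
  from balance_eq[OF ne this] show "height x y \<noteq> height y x"
    using evens_disjoint[OF D t] odds_disjoint[OF D t] evens_odds_disjoint[OF D t]
    unfolding height_def by argo
qed

text \<open>Quantifying over all consistent orientations makes this symmetric and invariant under
  forcing.\<close>
definition reorientable :: "'a \<Rightarrow> 'a \<Rightarrow> bool" where
  "reorientable x y \<longleftrightarrow> (\<exists>D z c. consistent D \<and> antimatched D x y z c)"

lemma reorientable_swap: "reorientable x y \<longleftrightarrow> reorientable y x"
proof -
  have "reorientable y x" if "reorientable x y" for x y
  proof -
    from that obtain D z c where "consistent D" "antimatched D x y z c"
      unfolding reorientable_def by blast
    then have "consistent (\<lambda>x y. D y x)" "antimatched (\<lambda>x y. D y x) y x z c"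
      using consistent_converse[of D] unfolding antimatched_def cycle_def but_def by simp_all
    then show ?thesis unfolding reorientable_def by blast
  qed
  then show ?thesis by blast
qed

lemma reorientable_forces:
  assumes f: "forces x y x' y'"
  shows "reorientable x y \<longleftrightarrow> reorientable x' y'"
proof -
  have "reorientable x' y'" if "reorientable x y" "forces x y x' y'" for x y x' y'
    using that antimatched_step(1)[OF _ _ that(2)] unfolding reorientable_def by meson
  then show ?thesis using f forces_sym by blast
qed

section \<open>Reorientation by the potential and its transitivity\<close>

definition repair :: "('a \<Rightarrow> 'a \<Rightarrow> bool) \<Rightarrow> 'a \<Rightarrow> 'a \<Rightarrow> bool" where
  "repair D x y \<longleftrightarrow> (\<exists>x' y'. forces x y x' y') \<and>
     (if reorientable x y then height x y < height y x \<or> height x y = height y x \<and> D x y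
      else D x y)"

lemma repair_consistent:
  assumes D: "consistent D"
  shows "consistent (repair D)"
  unfolding consistent_def
proof (intro conjI allI impI)
  fix x y x' y'
  assume f: "forces x y x' y'"
  have "height x' y' = - height y x" "height y' x' = - height x y"
    using height_forces f forces_swap by blast+
  then show "repair D x y \<longleftrightarrow> repair D x' y'"
    using f forces_sym[of x y x' y'] reorientable_forces[OF f] consistent_forces[OF D f]
    unfolding repair_def by auto
  show "repair D x y \<or> repair D y x"
    using f forces_swap[of x y x' y'] reorientable_swap[of x y] consistent_total[OF D f]
    unfolding repair_def by auto
next
  fix x y
  assume r: "repair D x y"
  then show "\<not> repair D y x"
    using reorientable_swap[of x y] consistent_asym[OF D, of x y]
    unfolding repair_def by (auto split: if_splits)
  show "\<exists>x' y'. forces x y x' y'" using r unfolding repair_def by blast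
qed

text \<open>A cycle of the first kind shares no arc with an antimatched cycle of any consistent
  orientation: via the third vertex z of the latter, (x, w), (z, w) and (y, w) would all be oriented
  alike, whereas D has arcs from w to x and from y to w.\<close>

lemma not_reorientable:
  assumes D: "consistent D" and c: "cycle D x y w"
    and n: "\<nexists>u. but u x y w" "\<nexists>u. but u y w x" "\<nexists>u. but u w x y"
    and d: "only d w x y"
  shows "\<not> reorientable x y"
proof
  assume "reorientable x y"
  then obtain D' z e where D': "consistent D'" and t: "antimatched D' x y z e"
    unfolding reorientable_def by blast
  obtain a where a: "but a y z x"
    using antimatched_rotate[OF D' t] unfolding antimatched_def by blast
  obtain b where b: "but b z x y"
    using antimatched_rotate[OF D'] t unfolding antimatched_def by metis
  have V: "x \<in> V" "y \<in> V" "z \<in> V" "w \<in> V"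
    using cycle_in_V[OF D c] cycle_in_V[OF D'] t unfolding antimatched_def by blast+
  have "\<not> adj w a" "\<not> adj w b" "\<not> adj z d"
    using n a b d antimatched_no_only(3)[OF D' t] unfolding but_def only_def by blast+
  then have "forces x w b d" "forces z w b d" "forces y w a d" "forces z w a d"
    using V a b d unfolding forces_def but_def only_def by auto
  then have "D x w \<longleftrightarrow> D z w" "D y w \<longleftrightarrow> D z w"
    using consistent_forces[OF D] by blast+
  then show False using c consistent_asym[OF D] unfolding cycle_def by blast
qed

lemma repair_acyclic:
  assumes D: "consistent D"
    and o: "\<And>x y z a b c. cycle D x y z \<Longrightarrow> only a x y z \<Longrightarrow> only b y z x \<Longrightarrow> only c z x y \<Longrightarrow> False"
  shows "\<not> cycle (repair D) x y z"
proof
  assume c: "cycle (repair D) x y z"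
  note R = repair_consistent[OF D]
  from R c show False
  proof (cases rule: cycle_dichotomy)
    case one
    \<comment> \<open>The repair leaves these three arcs as they are in D.\<close>
    have "\<not> reorientable x y" "\<not> reorientable y z" "\<not> reorientable z x"
      using not_reorientable[OF R c] not_reorientable[OF R cycle_rotate[OF c]]
        not_reorientable[OF R cycle_rotate[OF cycle_rotate[OF c]]] one by blast+
    then have "cycle D x y z" using c unfolding cycle_def repair_def by auto
    then show False using o one by blast
  next
    case two
    then obtain u where t: "antimatched (repair D) x y z u"
      using c unfolding antimatched_def by blast
    obtain v where t': "antimatched (repair D) y z x v" using antimatched_rotate[OF R t] .
    obtain w where t'': "antimatched (repair D) z x y w" using antimatched_rotate[OF R t'] .
    \<comment> \<open>The repaired orientation itself witnesses that p q is reorientable, so the arc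
      follows the heights, which differ.\<close>
    have less: "height p q < height q p" if "antimatched (repair D) p q r s" for p q r s
    proof -
      have "reorientable p q" using that R unfolding reorientable_def by blast
      then show ?thesis
        using height_antimatched(2)[OF R that] antimatched_cycle[OF that]
        unfolding repair_def by auto
    qed
    \<comment> \<open>Each height depends only on its first vertex and would increase strictly all
      around the cycle.\<close>
    show False
      using less[OF t] less[OF t'] less[OF t''] height_antimatched(1)[OF R t]
        height_antimatched(1)[OF R t'] height_antimatched(1)[OF R t''] by simp
  qed
qed

text \<open>The ends of a chain are constrained, hence oriented; the wrong direction would close a
  3-cycle.\<close>

lemma repair_trans:
  assumes D: "consistent D"
    and o: "\<And>x y z a b c. cycle D x y z \<Longrightarrow> only a x y z \<Longrightarrow> only b y z x \<Longrightarrow> only c z x y \<Longrightarrow> False"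
    and xy: "repair D x y" and yz: "repair D y z"
  shows "repair D x z"
proof -
  note R = repair_consistent[OF D]
  obtain x' z' where "forces x z x' z'" using consistent_chain_constrained[OF R xy yz] by blast
  then have "repair D x z \<or> repair D z x" using consistent_total[OF R] by blast
  moreover have "\<not> cycle (repair D) x y z"
    by (rule repair_acyclic[OF D]) (rule o)
  ultimately show ?thesis using xy yz unfolding cycle_def by blast
qed

subsection \<open>Transitive orientations of the avoidance graph\<close>

definition trans_orientation :: "('a set \<Rightarrow> 'a set \<Rightarrow> bool) \<Rightarrow> bool" where
  "trans_orientation Q \<longleftrightarrow>
     (\<forall>e g. Q e g \<longrightarrow> avoidance_adj V adj e g) \<and>
     (\<forall>e g. avoidance_adj V adj e g \<longrightarrow> Q e g \<or> Q g e) \<and>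
     (\<forall>e g. Q e g \<longrightarrow> \<not> Q g e) \<and>
     (\<forall>e f g. Q e f \<longrightarrow> Q f g \<longrightarrow> Q e g)"

lemma comparability_graph_iff:
  "comparability_graph (edges V adj) (avoidance_adj V adj) \<longleftrightarrow> (\<exists>Q. trans_orientation Q)"
  unfolding comparability_graph_def trans_orientation_def avoidance_adj_def
  by (rule arg_cong[of _ _ Ex]) blast

definition induced :: "('a set \<Rightarrow> 'a set \<Rightarrow> bool) \<Rightarrow> 'a \<Rightarrow> 'a \<Rightarrow> bool" where
  "induced Q x y \<longleftrightarrow> (\<exists>x' y'. forces x y x' y' \<and> Q {x, x'} {y, y'})"

text \<open>The partners are replaced one at a time. Two edges with a common vertex never avoid each
  other, so by transitivity an edge avoiding both lies on the same side of both.\<close>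

lemma induced_iff:
  assumes Q: "trans_orientation Q" and f: "forces x y a b"
  shows "induced Q x y \<longleftrightarrow> Q {x, a} {y, b}"
proof
  assume "induced Q x y"
  then obtain c d where g: "forces x y c d" and q: "Q {x, c} {y, d}"
    unfolding induced_def by blast
  have total: "Q e g \<or> Q g e" if "avoidance_adj V adj e g" for e g
    using that Q unfolding trans_orientation_def by blast
  have trans: "Q e h" if "Q e g" "Q g h" for e g h
    using that Q unfolding trans_orientation_def by blast
  have disj: "e \<inter> g = {}" if "Q e g" for e g
    using that Q avoidance_adj_disjoint unfolding trans_orientation_def by blast
  have "avoidance_adj V adj {x, c} {y, b}" "avoidance_adj V adj {x, a} {y, b}"
    using f forces_mix[OF g f] unfolding avoidance_adj_iff by blast+
  then have "Q {x, c} {y, b} \<or> Q {y, b} {x, c}" "Q {x, a} {y, b} \<or> Q {y, b} {x, a}"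
    using total by blast+
  moreover have "\<not> Q {y, b} {x, c}"
    using trans[of "{y, b}" "{x, c}" "{y, d}"] q disj[of "{y, b}" "{y, d}"] by blast
  moreover have "\<not> Q {y, b} {x, a}" if "Q {x, c} {y, b}"
    using trans[of "{x, c}" "{y, b}" "{x, a}"] that disj[of "{x, c}" "{x, a}"] by blast
  ultimately show "Q {x, a} {y, b}" by blast
next
  assume "Q {x, a} {y, b}"
  then show "induced Q x y" using f unfolding induced_def by blast
qed

text \<open>(x, y) and (x', y') are oriented by the same two edges {x, x'} and {y, y'}.\<close>

lemma induced_consistent:
  assumes Q: "trans_orientation Q"
  shows "consistent (induced Q)"
  unfolding consistent_def
proof (intro conjI allI impI)
  fix x y x' y'
  assume f: "forces x y x' y'"
  note s = f[unfolded forces_sym[of x y]] and w = f[unfolded forces_swap[of x y]]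
  show "induced Q x y \<longleftrightarrow> induced Q x' y'"
    unfolding induced_iff[OF Q f] induced_iff[OF Q s] by (simp add: insert_commute)
  have "avoidance_adj V adj {x, x'} {y, y'}" using f unfolding avoidance_adj_iff by blast
  then show "induced Q x y \<or> induced Q y x"
    unfolding induced_iff[OF Q f] induced_iff[OF Q w]
    using Q unfolding trans_orientation_def by blast
next
  fix x y
  assume r: "induced Q x y"
  then obtain x' y' where f: "forces x y x' y'" unfolding induced_def by blast
  then show "\<exists>x' y'. forces x y x' y'" by blast
  note w = f[unfolded forces_swap[of x y]]
  show "\<not> induced Q y x"
    using r Q unfolding induced_iff[OF Q f] induced_iff[OF Q w] trans_orientation_def by blast
qed

lemma induced_no_matched_cycle:
  assumes Q: "trans_orientation Q" and c: "cycle (induced Q) x y z"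
    and "only a x y z" "only b y z x" "only d z x y"
  shows False
proof -
  have "forces x y a b" "forces y z b d" "forces z x d a"
    using assms(3-5) cycle_in_V[OF induced_consistent[OF Q] c]
    unfolding forces_def only_def by auto
  then have "Q {x, a} {y, b}" "Q {y, b} {z, d}" "Q {z, d} {x, a}"
    using c induced_iff[OF Q] unfolding cycle_def by blast+
  then show False using Q unfolding trans_orientation_def by metis
qed

end

section \<open>Linear extensions and Slash-free orderings\<close>

lemma linear_extension:
  assumes "finite A"
    and "\<And>x y. R x y \<Longrightarrow> \<not> R y x" and "\<And>x y z. R x y \<Longrightarrow> R y z \<Longrightarrow> R x z"
  shows "\<exists>xs. set xs = A \<and> distinct xs \<and> sorted_wrt (\<lambda>x y. \<not> R y x) xs"
  using assms(1)
proof (induction A rule: finite_psubset_induct)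
  case (psubset A)
  show ?case
  proof (cases "A = {}")
    case True
    then show ?thesis by (intro exI[of _ "[]"]) simp
  next
    case False
    have "asymp_on A R" by (rule asymp_onI) (rule assms(2))
    moreover have "transp_on A R" by (rule transp_onI) (rule assms(3))
    ultimately obtain m where m: "m \<in> A" "\<forall>x\<in>A. x \<noteq> m \<longrightarrow> \<not> R x m"
      using Finite_Set.bex_min_element[OF psubset.hyps(1) _ _ False] by blast
    obtain xs where "set xs = A - {m}" "distinct xs" "sorted_wrt (\<lambda>x y. \<not> R y x) xs"
      using psubset.IH[of "A - {m}"] m(1) by blast
    moreover from this m have "sorted_wrt (\<lambda>x y. \<not> R y x) (m # xs)" by simp
    ultimately show ?thesis using m(1) by (intro exI[of _ "m # xs"]) auto
  qed
qed

context finite_reflexive_graph begin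

lemma strong_cocomparability_if:
  assumes Q: "trans_orientation Q"
  shows "strong_cocomparability V adj"
proof -
  let ?D = "repair (induced Q)"
  note I = induced_consistent[OF Q]
  note R = repair_consistent[OF I]
  have "?D x z" if "?D x y" "?D y z" for x y z
    using that by (rule repair_trans[OF I, rotated]) (rule induced_no_matched_cycle[OF Q])
  then obtain xs where xs: "set xs = V" "distinct xs" "sorted_wrt (\<lambda>x y. \<not> ?D y x) xs"
    using linear_extension[OF finite_V, of ?D, OF consistent_asym[OF R]] by blast
  have len: "length xs = card V" using xs distinct_card by metis
  have "bij_betw ((!) xs) {0..<card V} V"
    using bij_betw_nth[OF xs(2)] xs(1) len by (simp add: atLeast0LessThan)
  moreover have False
    if "i < j" "j < card V" "k < l" "l < card V" "\<not> adj (xs ! i) (xs ! k)"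
      "adj (xs ! i) (xs ! l)" "adj (xs ! j) (xs ! k)" "\<not> adj (xs ! j) (xs ! l)" for i j k l
  proof -
    have V: "xs ! i \<in> V" "xs ! j \<in> V" "xs ! k \<in> V" "xs ! l \<in> V"
      using that(1-4) len unfolding xs(1)[symmetric] by simp_all
    \<comment> \<open>Matching each row of a Slash with the column of its 1 yields forced pairs that
      the list orders oppositely.\<close>
    then have f: "forces (xs ! i) (xs ! j) (xs ! l) (xs ! k)"
      using that(5-8) unfolding forces_def by blast
    moreover have "\<not> ?D (xs ! j) (xs ! i)" "\<not> ?D (xs ! l) (xs ! k)"
      using xs(3) that(1-4) len by (auto simp: sorted_wrt_iff_nth_less)
    ultimately show False
      using consistent_total[OF R f] consistent_forces[OF R f] by blast
  qed
  ultimately show ?thesis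
    unfolding strong_cocomparability_def by (intro exI[of _ "(!) xs"] conjI notI) blast+
qed

lemma trans_orientation_if:
  assumes "strong_cocomparability V adj"
  shows "\<exists>Q. trans_orientation Q"
proof -
  obtain f where f: "bij_betw f {0..<card V} V"
    and slash: "\<And>i j k l. i < j \<Longrightarrow> j < card V \<Longrightarrow> k < l \<Longrightarrow> l < card V \<Longrightarrow>
      \<not> adj (f i) (f k) \<Longrightarrow> adj (f i) (f l) \<Longrightarrow> adj (f j) (f k) \<Longrightarrow> \<not> adj (f j) (f l) \<Longrightarrow> False"
    using assms unfolding strong_cocomparability_def by blast
  define r where "r = inv_into {0..<card V} f"
  have r: "r v < card V" "f (r v) = v" if "v \<in> V" for v
    using bij_betw_inv_into_right[OF f that] bij_betw_apply[OF bij_betw_inv_into[OF f] that]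
    unfolding r_def by auto
  have inj: "u = v" if "r u = r v" "u \<in> V" "v \<in> V" for u v
    using r that by metis
  have key: "r x < r y \<longleftrightarrow> r x' < r y'" if F: "forces x y x' y'" for x y x' y'
  proof -
    have V: "x \<in> V" "y \<in> V" "x' \<in> V" "y' \<in> V" using F unfolding forces_def by auto
    have ne: "r x \<noteq> r y" "r x' \<noteq> r y'"
      using forces_disjoint[OF F] inj V by auto
    \<comment> \<open>Otherwise rows x, y and columns y', x' form a Slash.\<close>
    have "\<not> (r x < r y \<and> r y' < r x')" if "forces x y x' y'" for x y x' y'
      using slash[of "r x" "r y" "r y'" "r x'"] that r unfolding forces_def by auto
    from this[OF F] this[OF F[unfolded forces_sym[of x y]]] ne show ?thesis
      by (meson linorder_neqE_nat less_asym)
  qed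
  define Q where "Q e g \<longleftrightarrow> (\<exists>x y x' y'. e = {x, x'} \<and> g = {y, y'} \<and> forces x y x' y' \<and> r x < r y)"
    for e g
  have trans: "Q e h" if eg: "Q e g" and gh: "Q g h" for e g h
  proof -
    obtain y z y' z' where g: "g = {y, y'}" and h: "h = {z, z'}"
      and F: "forces y z y' z'" and l: "r y < r z" "r y' < r z'"
      using gh key unfolding Q_def by blast
    obtain p a p' a' where e: "e = {p, p'}" and a: "{y, y'} = {a, a'}" and F': "forces p a p' a'"
      and k: "r p < r a" "r p' < r a'"
      using eg key unfolding Q_def g by blast
    \<comment> \<open>The two forcings may list the ends of g in different order; reversing one
      aligns them.\<close>
    obtain x x' where e: "e = {x, x'}" and E: "forces x y x' y'" and k: "r x < r y" "r x' < r y'"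
    proof (cases "a = y \<and> a' = y'")
      case True
      then show thesis using that e F' k by blast
    next
      case False
      then have "a = y'" "a' = y" using a by (auto simp: doubleton_eq_iff)
      then show thesis using that[of p' p] e F'[unfolded forces_sym[of p]] k by blast
    qed
    \<comment> \<open>Such an edge would make x < y force z' < y', against the order of y' and
      z'.\<close>
    have "\<not> adj x z'"
    proof
      assume "adj x z'"
      then have "forces x y z' y'" using E F unfolding forces_def by blast
      from key[OF this] show False using k(1) l(2) by simp
    qed
    moreover have "\<not> adj x' z"
    proof
      assume "adj x' z"
      then have "forces x' y' z y" using E F adj_sym unfolding forces_def by blast
      from key[OF this] show False using k(2) l(1) by simp
    qed
    ultimately have "forces x z x' z'"
      using E F adj_sym unfolding forces_def by blast
    moreover have "r x < r z" using k(1) l(1) by simp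
    ultimately show ?thesis using e h unfolding Q_def by blast
  qed
  have disjoint: "e \<inter> g = {} \<and> e \<noteq> {}" if "Q e g" for e g
    using that forces_disjoint unfolding Q_def by blast
  have total: "Q e g \<or> Q g e" if "avoidance_adj V adj e g" for e g
  proof -
    obtain x y x' y' where e: "e = {x, x'}" "g = {y, y'}" and F: "forces x y x' y'"
      using \<open>avoidance_adj V adj e g\<close> unfolding avoidance_adj_iff by blast
    have "r x \<noteq> r y"
      using forces_disjoint[OF F] inj F unfolding forces_def by blast
    then have "r x < r y \<or> r y < r x" by linarith
    then show ?thesis using e F F[unfolded forces_swap[of x]] unfolding Q_def by blast
  qed
  have "trans_orientation Q"
    unfolding trans_orientation_def
  proof (intro conjI allI impI)
    show "avoidance_adj V adj e g" if "Q e g" for e g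
      using that unfolding Q_def avoidance_adj_iff by blast
    \<comment> \<open>Transitivity would give \<open>Q e e\<close>, but related edges are disjoint
      and nonempty.\<close>
    show "\<not> Q g e" if "Q e g" for e g
      using disjoint[of e e] trans[OF that, of e] by blast
  qed (use total trans in blast)+
  then show ?thesis by blast
qed

end

theorem theorem7:
  fixes V :: "'a set" and adj :: "'a \<Rightarrow> 'a \<Rightarrow> bool"
  assumes "finite V" and "reflexive_graph V adj"
  shows "strong_cocomparability V adj \<longleftrightarrow>
         comparability_graph (edges V adj) (avoidance_adj V adj)"
proof -
  interpret finite_reflexive_graph V adj using assms by unfold_locales
  show ?thesis
    unfolding comparability_graph_iff
    using strong_cocomparability_if trans_orientation_if by blast
qed

end
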